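(* For any odd prime $p$ and integer $x$, we have $$\sum_{k=0}^{p-1}(2k+1)A_k(x)\equiv p\left(\frac xp\right)\pmod{p^2}.$$
   Context: For $n\in\{0,1,2,\ldots\}$, $A_n(x)=\sum_{k=0}^n\binom nk^2\binom{n+k}k^2x^k$. The symbol $\left(\frac{\cdot}p\right)$ is the Legendre symbol (equal to $0$ when $p\mid x$). *)

theory Defs
  imports "HOL-Number_Theory.Number_Theory"
begin

definition A :: "nat \<Rightarrow> int \<Rightarrow> int" where
  "A n x = (\<Sum>k=0..n. int (n choose k) ^ 2 * int ((n + k) choose k) ^ 2 * x ^ k)"

end

theory Submission
  imports Defs
begin

text \<open>
  Interchanging the two summations reduces the claim to the coefficient of each power
  \<open>x ^ k\<close>, namely the sum over \<open>m < p\<close> of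
  \<open>(2 * m + 1) * ((m choose k) * ((m + k) choose k)) ^ 2\<close>. This sum telescopes
  (\<open>sum_odd_mult_choose_squares\<close>), with value
  \<open>(2 * k + 1) * (((2 * k) choose k) * ((p + k) choose (2 * k + 1))) ^ 2\<close>.

  Now let \<open>p = 2 * h + 1\<close>. If \<open>k < h\<close>, the prime \<open>p\<close> divides the second binomial
  coefficient; if \<open>h < k < p\<close>, it divides the first one, both times because a carry occurs
  in base \<open>p\<close> (\<open>prime_dvd_choose_if_carry\<close>). As the product is squared, these terms vanish
  modulo \<open>p ^ 2\<close>. The middle term \<open>k = h\<close> carries the single factor \<open>2 * h + 1 = p\<close>, so
  the rest of it is needed only modulo \<open>p\<close>, where both binomial coefficients square to 1.
  What remains is \<open>p * x ^ h\<close>, and Euler's criterion identifies \<open>x ^ h\<close> with the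
  Legendre symbol modulo \<open>p\<close>.
\<close>

lemma choose_mult_choose_add:
  "(m choose k) * ((m + k) choose k) = ((2 * k) choose k) * ((m + k) choose (2 * k))"
proof (cases "k \<le> m")
  case True
  then show ?thesis
    using choose_mult[of k "2 * k" "m + k"] by (simp add: mult_2 mult.commute)
qed (simp add: binomial_eq_0)

text \<open>
  With \<open>a = (n + k) choose (2 * k + 1)\<close> and \<open>b = (n + k) choose (2 * k)\<close>, passing from
  \<open>n\<close> to \<open>n + 1\<close> replaces \<open>a\<close> by \<open>a + b\<close> by Pascal's rule, and \<open>(2 * k + 1) * a = (n - k) * b\<close>.
  Hence \<open>(2 * k + 1) * ((a + b) ^ 2 - a ^ 2) = (2 * (n - k) + 2 * k + 1) * b ^ 2\<close>, which
  is the summand of index \<open>n\<close> up to the factor \<open>((2 * k) choose k) ^ 2\<close>.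
\<close>

lemma sum_odd_mult_choose_squares:
  "(\<Sum>m<n. (2 * int m + 1) * (int (m choose k) ^ 2 * int ((m + k) choose k) ^ 2))
    = (2 * int k + 1) * int ((2 * k) choose k) ^ 2 * int ((n + k) choose (2 * k + 1)) ^ 2"
proof (induction n)
  case 0
  show ?case by (simp add: binomial_eq_0)
next
  case (Suc n)
  define a where "a = int ((n + k) choose (2 * k + 1))"
  define b where "b = int ((n + k) choose (2 * k))"
  define c where "c = int ((2 * k) choose k)"
  have pascal: "int ((Suc n + k) choose (2 * k + 1)) = a + b"
    by (simp add: a_def b_def)
  have summand: "int (n choose k) * int ((n + k) choose k) = c * b"
    unfolding b_def c_def using choose_mult_choose_add[of n k]
    by (metis of_nat_mult)
  have ratio: "(2 * int k + 1) * a = (int n - int k) * b"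
  proof (cases "k \<le> n")
    case True
    have "Suc (2 * k) * ((n + k) choose Suc (2 * k)) = (n - k) * ((n + k) choose (2 * k))"
      using binomial_absorption[of "2 * k" "n + k"] binomial_absorb_comp[of "n + k" "2 * k"] by simp
    then have "int (Suc (2 * k)) * int ((n + k) choose Suc (2 * k))
        = int (n - k) * int ((n + k) choose (2 * k))"
      by (metis of_nat_mult)
    with True show ?thesis
      by (simp add: a_def b_def of_nat_diff add.commute del: binomial_Suc_Suc)
  qed (simp add: a_def b_def binomial_eq_0)
  have "(2 * int k + 1) * c ^ 2 * (a + b) ^ 2
      = (2 * int k + 1) * c ^ 2 * a ^ 2 + c ^ 2 * b * (2 * ((2 * int k + 1) * a) + (2 * int k + 1) * b)"
    by (simp add: power2_eq_square algebra_simps)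
  also have "\<dots> = (2 * int k + 1) * c ^ 2 * a ^ 2 + (2 * int n + 1) * (c * b) ^ 2"
    unfolding ratio by (simp add: power2_eq_square algebra_simps)
  finally show ?case
    unfolding sum.lessThan_Suc Suc.IH pascal a_def[symmetric] c_def[symmetric]
    by (simp only: summand flip: power_mult_distrib)
qed

text \<open>
  Kummer's carry criterion for one-digit summands: \<open>p\<close> divides \<open>fact (a + b)\<close> but neither
  \<open>fact a\<close> nor \<open>fact b\<close>.
\<close>

lemma prime_dvd_choose_if_carry:
  fixes p a b :: nat
  assumes "prime p" and "a < p" and "b < p" and "p \<le> a + b"
  shows "p dvd ((a + b) choose a)"
proof -
  have "p dvd fact a * fact b * ((a + b) choose a)"
    using binomial_fact_lemma[of a "a + b"] assms by (simp add: prime_dvd_fact_iff)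
  then show ?thesis
    using assms by (simp add: prime_dvd_mult_iff prime_dvd_fact_iff)
qed

lemma choose_prime_minus_one_cong:
  fixes p k :: nat
  assumes "prime p" and "k < p"
  shows "[int ((p - 1) choose k) = (-1) ^ k] (mod int p)"
  using \<open>k < p\<close>
proof (induction k)
  case 0
  show ?case by simp
next
  case (Suc k)
  have "int ((p - 1) choose Suc k) = int (p choose Suc k) - int ((p - 1) choose k)"
    using binomial_Suc_Suc[of "p - 1" k] prime_gt_0_nat[OF \<open>prime p\<close>] by simp
  moreover have "[int (p choose Suc k) = 0] (mod int p)"
    using Suc.prems prime_dvd_choose_if_carry[OF \<open>prime p\<close>, of "Suc k" "p - Suc k"]
    by (simp add: cong_0_iff)
  ultimately show ?case
    using cong_diff[OF _ Suc.IH] Suc.prems by fastforce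
qed

text \<open>
  Pascal's rule adds \<open>(p + k) choose (p - 1)\<close> at each step; this is divisible by \<open>p\<close>, since
  \<open>(p - 1) + (k + 1)\<close> carries in base \<open>p\<close>.
\<close>

lemma choose_prime_add_cong_one:
  fixes p k :: nat
  assumes "prime p" and "k < p"
  shows "[int ((p + k) choose p) = 1] (mod int p)"
  using \<open>k < p\<close>
proof (induction k)
  case 0
  show ?case by simp
next
  case (Suc k)
  have "int ((p + Suc k) choose p) = int ((p + k) choose (p - 1)) + int ((p + k) choose p)"
    using binomial_Suc_Suc[of "p + k" "p - 1"] prime_gt_0_nat[OF \<open>prime p\<close>] by simp
  moreover have "[int ((p + k) choose (p - 1)) = 0] (mod int p)"
    using Suc.prems prime_dvd_choose_if_carry[OF \<open>prime p\<close>, of "p - 1" "Suc k"]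
    by (simp add: cong_0_iff)
  ultimately show ?case
    using cong_add[OF _ Suc.IH] Suc.prems by fastforce
qed

lemma central_choose_product_square_cong_one:
  fixes p h :: nat
  assumes "prime p" and "p = 2 * h + 1"
  shows "[int ((2 * h) choose h) ^ 2 * int ((p + h) choose (2 * h + 1)) ^ 2 = 1] (mod int p)"
proof -
  have "[int ((2 * h) choose h) = (-1) ^ h] (mod int p)"
    using choose_prime_minus_one_cong[OF \<open>prime p\<close>, of h] assms by simp
  moreover have "[int ((p + h) choose (2 * h + 1)) = 1] (mod int p)"
    using choose_prime_add_cong_one[OF \<open>prime p\<close>, of h] assms by simp
  ultimately have "[int ((2 * h) choose h) ^ 2 * int ((p + h) choose (2 * h + 1)) ^ 2
      = ((-1) ^ h) ^ 2 * 1 ^ 2] (mod int p)"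
    by (intro cong_mult cong_pow)
  then show ?thesis by (simp flip: power_mult)
qed

text \<open>
  In base \<open>p\<close>, the sum \<open>(2 * k + 1) + (p - k - 1)\<close> carries if \<open>k < h\<close>, and \<open>k + k\<close> carries
  if \<open>k > h\<close>.
\<close>

lemma prime_dvd_choose_product:
  fixes p h k :: nat
  assumes "prime p" and "p = 2 * h + 1" and "k < p" and "k \<noteq> h"
  shows "p dvd ((2 * k) choose k) * ((p + k) choose (2 * k + 1))"
proof (cases "k < h")
  case True
  then have "p dvd ((p + k) choose (2 * k + 1))"
    using prime_dvd_choose_if_carry[OF \<open>prime p\<close>, of "2 * k + 1" "p - k - 1"] assms
    by (simp add: add.commute del: binomial_Suc_Suc)
  then show ?thesis by simp
next
  case False
  then have "p dvd ((2 * k) choose k)"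
    using prime_dvd_choose_if_carry[OF \<open>prime p\<close>, of k k] assms by (simp add: mult_2)
  then show ?thesis by simp
qed

lemma sum_odd_mult_A:
  "(\<Sum>m<n. (2 * int m + 1) * A m x)
    = (\<Sum>k<n. (2 * int k + 1) * int ((2 * k) choose k) ^ 2
        * int ((n + k) choose (2 * k + 1)) ^ 2 * x ^ k)"
proof -
  have "A m x = (\<Sum>k<n. int (m choose k) ^ 2 * int ((m + k) choose k) ^ 2 * x ^ k)"
    if "m < n" for m
    unfolding A_def using that by (intro sum.mono_neutral_left) (auto simp: binomial_eq_0)
  then have "(\<Sum>m<n. (2 * int m + 1) * A m x)
      = (\<Sum>m<n. \<Sum>k<n. (2 * int m + 1)
          * (int (m choose k) ^ 2 * int ((m + k) choose k) ^ 2) * x ^ k)"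
    by (simp add: sum_distrib_left mult.assoc)
  also have "\<dots> = (\<Sum>k<n. (\<Sum>m<n. (2 * int m + 1)
          * (int (m choose k) ^ 2 * int ((m + k) choose k) ^ 2)) * x ^ k)"
    by (subst sum.swap) (simp add: sum_distrib_right)
  finally show ?thesis
    by (simp only: sum_odd_mult_choose_squares)
qed

theorem corollary1p3:
  fixes p :: nat and x :: int
  assumes "prime p" and "odd p"
  shows "[(\<Sum>k=0..p-1. (2 * int k + 1) * A k x) = int p * Legendre x (int p)] (mod (int p ^ 2))"
proof -
  obtain h where h: "p = 2 * h + 1"
    using \<open>odd p\<close> by (elim oddE)
  define t where "t k = (2 * int k + 1) * int ((2 * k) choose k) ^ 2
      * int ((p + k) choose (2 * k + 1)) ^ 2 * x ^ k" for k
  have t_0: "[t k = 0] (mod (int p ^ 2))" if "k < p" "k \<noteq> h" for k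
  proof -
    have "int p dvd int ((2 * k) choose k) * int ((p + k) choose (2 * k + 1))"
      using prime_dvd_choose_product[OF \<open>prime p\<close> h that] by (metis of_nat_dvd_iff of_nat_mult)
    then have "int p ^ 2 dvd (int ((2 * k) choose k) * int ((p + k) choose (2 * k + 1))) ^ 2"
      by (rule dvd_power_same)
    then show ?thesis
      unfolding t_def cong_0_iff power_mult_distrib mult.assoc
      by (metis dvd_mult dvd_mult2 mult.assoc)
  qed
  \<comment> \<open>The factor \<open>2 * h + 1 = p\<close> lifts a congruence modulo \<open>p\<close> to one modulo \<open>p ^ 2\<close>.\<close>
  have t_h: "[t h = int p * Legendre x (int p)] (mod (int p ^ 2))"
  proof -
    have "2 < int p"
      using prime_gt_1_nat[OF \<open>prime p\<close>] h by simp
    then have "[Legendre x (int p) = x ^ h] (mod int p)"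
      using euler_criterion[of p x] \<open>prime p\<close> h by simp
    moreover note central_choose_product_square_cong_one[OF \<open>prime p\<close> h]
    ultimately have "[int ((2 * h) choose h) ^ 2 * int ((p + h) choose (2 * h + 1)) ^ 2 * x ^ h
        = 1 * Legendre x (int p)] (mod int p)"
      by (intro cong_mult cong_sym[of "Legendre x (int p)"])
    then have "int p * int p dvd int p * (int ((2 * h) choose h) ^ 2
        * int ((p + h) choose (2 * h + 1)) ^ 2 * x ^ h - 1 * Legendre x (int p))"
      unfolding cong_iff_dvd_diff by (rule mult_dvd_mono[OF dvd_refl])
    moreover have "2 * int h + 1 = int p"
      using h by simp
    ultimately show ?thesis
      unfolding t_def cong_iff_dvd_diff by (simp add: power2_eq_square algebra_simps)
  qed
  have "{0..p - 1} = {..<p}"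
    using h by auto
  then have "(\<Sum>k=0..p-1. (2 * int k + 1) * A k x) = (\<Sum>k<p. t k)"
    by (simp add: sum_odd_mult_A t_def)
  also have "\<dots> = t h + (\<Sum>k\<in>{..<p} - {h}. t k)"
    using h by (intro sum.remove) auto
  also have "[\<dots> = int p * Legendre x (int p) + (\<Sum>k\<in>{..<p} - {h}. 0)] (mod (int p ^ 2))"
    using t_0 by (intro cong_add[OF t_h] cong_sum) auto
  finally show ?thesis by simp
qed

end
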